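(* Fix $B<0$ and $\delta\in[0,1)$. Assume that the pairs of potential outcomes $(Y_{i,t}(0),Y_{i,t}(1))$ are independent across different units $i$ and experiment stages $t$. The experiment whose treatment group sizes $m_t$ are produced by the algorithm described in the context is $(\delta,B)$-RRC if, for each stage $t\ge1$ where $m_t\neq0$, the following conditions hold: $$\mathbb P\left(\frac{s^{\mathcal T}_t(1)-S^{\mathcal T}_t(0)-\breve\mu_t}{\breve\sigma_t}\le z_t\,\Big|\,\mathcal F_{t-1}\right)\le\Phi(z_t),\qquad z_t\le\frac{\breve\mu_t-\tilde\mu_t}{\tilde\sigma_t-\breve\sigma_t},$$ where $$\breve\mu_t:=\mathbb E\left[s^{\mathcal T}_t(1)-S^{\mathcal T}_t(0)\mid\mathcal F_{t-1}\right],\quad \breve\sigma_t^2:=\mathbb V\left[s^{\mathcal T}_t(1)-S^{\mathcal T}_t(0)\mid\mathcal F_{t-1}\right],\quad z_t:=\frac{b_t-S^{\mathcal T}_{t-1}(1)-\tilde\mu_t}{\tilde\sigma_t},$$ $\tilde\mu_t:=\tilde\mu_t(m_t)$, $\tilde\sigma_t:=\tilde\sigma_t(m_t)$, and $\Phi$ is the standard normal CDF.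
   Context: Setting. At stages $t=1,2,\dots,T$ ($T$ not necessarily fixed) there is a set $\mathcal N_t$ of $N_t$ units ($N_t$ known). Before stage $t$ a size $m_t$ is chosen on the basis of past observations, and a treatment group $\mathcal T_t\subseteq\mathcal N_t$ with $|\mathcal T_t|=m_t$ is chosen at random; $\mathcal C_t=\mathcal N_t\setminus\mathcal T_t$ is the control group, and $W_{i,t}=1$ if $i\in\mathcal T_t$, $W_{i,t}=0$ otherwise. Unit $i\in\mathcal N_t$ has potential outcomes $Y_{i,t}(0),Y_{i,t}(1)\in\mathbb R$ and only $Y_{i,t}(W_{i,t})$ is observed. The two coordinates of a pair $(Y_{i,t}(0),Y_{i,t}(1))$ may be dependent and/or discrete-valued, and the distribution of the pair may differ across $i,t$. $\mathcal F_t$ is the $\sigma$-algebra generated by all assignments and observed outcomes in stages $1,\dots,t$; $\mathcal F_0$ is trivial. The cost of stage $t$ is $r_t=\sum_{i\in\mathcal T_t}(Y_{i,t}(1)-Y_{i,t}(0))$ ($=0$ if $\mathcal T_t=\emptyset$) and $R_t=\sum_{k\le t}r_k$. An experiment running for $T$ stages that selects the size of $\mathcal T_t$ before stage $t$ is $(\delta,B)$-RRC (risk-of-ruin-constrained) if $\mathbb P(R_T>B)\ge1-\delta$. Statistics. $s^{\mathcal T}_t(w)=\sum_{i\in\mathcal T_t}Y_{i,t}(w)$, $S^{\mathcal T}_t(w)=\sum_{k\le t}s^{\mathcal T}_k(w)$, $s^{\mathcal C}_t(w)=\sum_{i\in\mathcal C_t}Y_{i,t}(w)$, $S^{\mathcal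 C}_t(w)=\sum_{k\le t}s^{\mathcal C}_k(w)$, $M_t^{(1)}=\sum_{k\le t}m_k$, $M_t^{(0)}=\sum_{k\le t}(N_k-m_k)$ (all $0$ for $t=0$). The algorithm uses working parameters $\mu_0(w)\in\mathbb R$, $\sigma_0(w)^2>0$, $\sigma(w)^2>0$, $w=0,1$ (coming from a Gaussian model that is not assumed to hold here). For $t\ge1$: $$\sigma_{p,t}(w)^2=\Big(\tfrac1{\sigma_0(w)^2}+\tfrac{M^{(w)}_{t-1}}{\sigma(w)^2}\Big)^{-1},$$ $$\mu_{p,t}(0)=\sigma_{p,t}(0)^2\Big(\tfrac{\mu_0(0)}{\sigma_0(0)^2}+\tfrac{S^{\mathcal C}_{t-1}(0)}{\sigma(0)^2}\Big),\quad \mu_{p,t}(1)=\sigma_{p,t}(1)^2\Big(\tfrac{\mu_0(1)}{\sigma_0(1)^2}+\tfrac{S^{\mathcal T}_{t-1}(1)}{\sigma(1)^2}\Big),$$ $$\tilde\mu_t(m)=\mu_{p,t}(1)\,m-\mu_{p,t}(0)\,(m+M^{(1)}_{t-1}),$$ $$\tilde\sigma_t^2(m)=m^2\sigma_{p,t}(1)^2+m\,\sigma(1)^2+(m+M^{(1)}_{t-1})^2\sigma_{p,t}(0)^2+(m+M^{(1)}_{t-1})\,\sigma(0)^2,\qquad \tilde\sigma_t(m)=\sqrt{\tilde\sigma_t^2(m)}.$$ Algorithm. Input $B<0$, $\delta\in[0,1)$. Start with $t=1$. While $\prod_{k=1}^{t-1}(1-\Delta_k)>1-\delta$ (the empty product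 is $1$), do the following at stage $t$. 1. Choose $\Delta_t\in\big[0,\,1-\tfrac{1-\delta}{\prod_{k=1}^{t-1}(1-\Delta_k)}\big]$ and $b_t\ge B$. 2. Estimate the data variances $\sigma(w)^2$, $w=0,1$, if they are unknown: for $t\ge2$, use the sample variance (denominator $M_{t-1}^{(w)}-1$) of the outcomes observed in stages $1,\dots,t-1$ in the control groups (for $w=0$) and in the treatment groups (for $w=1$); for $t=1$, use some prior estimate. These values are used as $\sigma(w)^2$ in the formulas of stage $t$. 3. Compute $\mu_{p,t}(w),\sigma_{p,t}(w)^2$ for $w=0,1$, $q_t=\Phi^{-1}(\Delta_t)$, and $A_t=q_t^2(\sigma_{p,t}(1)^2+\sigma_{p,t}(0)^2)-(\mu_{p,t}(1)-\mu_{p,t}(0))^2$, $B_t=q_t^2(\sigma(1)^2+\sigma(0)^2+2\sigma_{p,t}(0)^2M^{(1)}_{t-1})+2(b_t-S^{\mathcal T}_{t-1}(1)+\mu_{p,t}(0)M^{(1)}_{t-1})(\mu_{p,t}(1)-\mu_{p,t}(0))$, $C_t=q_t^2\sigma_{p,t}(0)^2(M^{(1)}_{t-1})^2+q_t^2\sigma(0)^2M^{(1)}_{t-1}-(b_t-S^{\mathcal T}_{t-1}(1)+\mu_{p,t}(0)M^{(1)}_{t-1})^2$. 4. If $\dfrac{b_t-S^{\mathcal T}_{t-1}(1)-\tilde\mu_t(\lfloor N_t/2\rfloor)}{\tilde\sigma_t(\lfloor N_t/2\rfloor)}\le q_t$, set $m_t=\lfloor N_t/2\rfloor$. Else, if $B_t^2-4A_tC_t<0$,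 set $m_t=0$. Else let $\mathcal M_t=\Big\{\Big\lfloor\tfrac{-B_t+\sqrt{B_t^2-4A_tC_t}}{2A_t}\Big\rfloor,\Big\lfloor\tfrac{-B_t-\sqrt{B_t^2-4A_tC_t}}{2A_t}\Big\rfloor\Big\}$ and $\mathcal V_t=\Big\{m\in\mathcal M_t\cap[0,\tfrac{N_t}2]:\ \tfrac{b_t-S^{\mathcal T}_{t-1}(1)-\tilde\mu_t(m)}{\tilde\sigma_t(m)}\le q_t\Big\}$; set $m_t=\max\mathcal V_t$ if $\mathcal V_t\ne\emptyset$ and $m_t=0$ otherwise. 5. Output $m_t$, run stage $t$ with treatment group size $m_t$, observe $s^{\mathcal T}_t(1)$ and $s^{\mathcal C}_t(0)$, update $M_t^{(0)},M_t^{(1)},S^{\mathcal T}_t(1),S^{\mathcal C}_t(0)$, and replace $t$ by $t+1$. $T$ is the number of stages run.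
   Formalization: The formal statement additionally assumes 0 < σ̆_t < σ̃_t at each stage with m_t ≠ 0; if σ̃_t < σ̆_t the claim fails (e.g. Gaussian outcomes with μ̆_t = μ̃_t and huge true variance), and if σ̆_t = 0 or σ̃_t = σ̆_t a quotient is undefined. *)

theory Defs
  imports "HOL-Probability.Probability"
begin

text \<open>
  The data of one experiment.  Arms are \<open>w = 0\<close> (control) and \<open>w = 1\<close> (treatment); stages are
  numbered from 1.  Every process is a total function of the stage, but only stages
  \<open>1 \<le> t \<le> stages E \<omega>\<close> are actually run.  Apart from the potential outcomes, the values at later
  stages are dummies: only measurability and \<open>treated E t \<omega> \<subseteq> units E t\<close> are required of them.
  The event \<open>t \<le> stages E \<omega>\<close> lies in $\mathcal F_{t-1}$, so on it conditional expectations given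
  $\mathcal F_{t-1}$ do not depend on the dummies.
\<close>

record ('a, 'u) trial =
  units :: "nat \<Rightarrow> 'u set"                          \<comment> \<open>$\mathcal N_t$\<close>
  outcome :: "nat \<Rightarrow> nat \<Rightarrow> 'u \<Rightarrow> 'a \<Rightarrow> real"       \<comment> \<open>\<open>outcome E w t i\<close> is $Y_{i,t}(w)$\<close>
  tsize :: "nat \<Rightarrow> 'a \<Rightarrow> nat"                       \<comment> \<open>$m_t$\<close>
  treated :: "nat \<Rightarrow> 'a \<Rightarrow> 'u set"                  \<comment> \<open>$\mathcal T_t$\<close>
  stages :: "'a \<Rightarrow> nat"                             \<comment> \<open>$T$\<close>
  prior_mean :: "nat \<Rightarrow> real"                       \<comment> \<open>$\mu_0(w)$\<close>
  prior_var :: "nat \<Rightarrow> real"                        \<comment> \<open>$\sigma_0(w)^2$\<close>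
  data_var :: "nat \<Rightarrow> nat \<Rightarrow> 'a \<Rightarrow> real"            \<comment> \<open>\<open>data_var E w t\<close> is the $\sigma(w)^2$ used in stage $t$\<close>
  risk :: "nat \<Rightarrow> 'a \<Rightarrow> real"                       \<comment> \<open>$\Delta_t$\<close>
  bound :: "nat \<Rightarrow> 'a \<Rightarrow> real"                      \<comment> \<open>$b_t$\<close>

section \<open>Observations and statistics\<close>

definition control :: "('a, 'u) trial \<Rightarrow> nat \<Rightarrow> 'a \<Rightarrow> 'u set" where
  "control E t \<omega> = units E t - treated E t \<omega>"

definition W :: "('a, 'u) trial \<Rightarrow> nat \<Rightarrow> 'u \<Rightarrow> 'a \<Rightarrow> nat" where
  "W E t i \<omega> = (if i \<in> treated E t \<omega> then 1 else 0)"

definition observed :: "('a, 'u) trial \<Rightarrow> nat \<Rightarrow> 'u \<Rightarrow> 'a \<Rightarrow> real" where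
  "observed E t i \<omega> = outcome E (W E t i \<omega>) t i \<omega>"

definition generated_by :: "'a measure \<Rightarrow> ('a \<Rightarrow> real) set \<Rightarrow> 'a measure" where
  "generated_by M \<X> = sigma (space M) {X -` A \<inter> space M | X A. X \<in> \<X> \<and> A \<in> sets borel}"

text \<open>$\mathcal F_t$\<close>
definition history :: "'a measure \<Rightarrow> ('a, 'u) trial \<Rightarrow> nat \<Rightarrow> 'a measure" where
  "history M E t = generated_by M
     (\<Union>k\<in>{1..t}. \<Union>i\<in>units E k. {\<lambda>\<omega>. real (W E k i \<omega>), observed E k i})"

definition sT :: "('a, 'u) trial \<Rightarrow> nat \<Rightarrow> nat \<Rightarrow> 'a \<Rightarrow> real" where
  "sT E w t \<omega> = (\<Sum>i\<in>treated E t \<omega>. outcome E w t i \<omega>)"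

definition ST :: "('a, 'u) trial \<Rightarrow> nat \<Rightarrow> nat \<Rightarrow> 'a \<Rightarrow> real" where
  "ST E w t \<omega> = (\<Sum>k=1..t. sT E w k \<omega>)"

definition sC :: "('a, 'u) trial \<Rightarrow> nat \<Rightarrow> nat \<Rightarrow> 'a \<Rightarrow> real" where
  "sC E w t \<omega> = (\<Sum>i\<in>control E t \<omega>. outcome E w t i \<omega>)"

definition SC :: "('a, 'u) trial \<Rightarrow> nat \<Rightarrow> nat \<Rightarrow> 'a \<Rightarrow> real" where
  "SC E w t \<omega> = (\<Sum>k=1..t. sC E w k \<omega>)"

text \<open>$M_t^{(w)}$; the natural-number subtraction is harmless because \<open>tsize E k \<omega> \<le> card (units E k)\<close>.\<close>
definition cum_size :: "('a, 'u) trial \<Rightarrow> nat \<Rightarrow> nat \<Rightarrow> 'a \<Rightarrow> nat" where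
  "cum_size E w t \<omega> =
     (\<Sum>k=1..t. if w = 1 then tsize E k \<omega> else card (units E k) - tsize E k \<omega>)"

definition stage_cost :: "('a, 'u) trial \<Rightarrow> nat \<Rightarrow> 'a \<Rightarrow> real" where
  "stage_cost E t \<omega> = (\<Sum>i\<in>treated E t \<omega>. outcome E 1 t i \<omega> - outcome E 0 t i \<omega>)"

definition total_cost :: "('a, 'u) trial \<Rightarrow> nat \<Rightarrow> 'a \<Rightarrow> real" where
  "total_cost E t \<omega> = (\<Sum>k=1..t. stage_cost E k \<omega>)"

text \<open>Sample variance, and its sample mean, of the arm-\<open>w\<close> outcomes observed in stages \<open>1, \<dots>, t\<close>.\<close>

definition arm :: "('a, 'u) trial \<Rightarrow> nat \<Rightarrow> nat \<Rightarrow> 'a \<Rightarrow> 'u set" where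
  "arm E w t \<omega> = (if w = 1 then treated E t \<omega> else control E t \<omega>)"

definition sample_mean :: "('a, 'u) trial \<Rightarrow> nat \<Rightarrow> nat \<Rightarrow> 'a \<Rightarrow> real" where
  "sample_mean E w t \<omega> =
     (\<Sum>k=1..t. \<Sum>i\<in>arm E w k \<omega>. observed E k i \<omega>) / real (cum_size E w t \<omega>)"

definition sample_var :: "('a, 'u) trial \<Rightarrow> nat \<Rightarrow> nat \<Rightarrow> 'a \<Rightarrow> real" where
  "sample_var E w t \<omega> =
     (\<Sum>k=1..t. \<Sum>i\<in>arm E w k \<omega>. (observed E k i \<omega> - sample_mean E w t \<omega>)\<^sup>2)
       / (real (cum_size E w t \<omega>) - 1)"

section \<open>The randomised experiment\<close>

text \<open>All potential outcomes together with the assignments made before stage \<open>t\<close>.\<close>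
definition pre_assignment :: "'a measure \<Rightarrow> ('a, 'u) trial \<Rightarrow> nat \<Rightarrow> 'a measure" where
  "pre_assignment M E t = generated_by M
     ({outcome E w k i | w k i. w \<in> {0, 1} \<and> 1 \<le> k \<and> i \<in> units E k} \<union>
      {\<lambda>\<omega>. real (W E k i \<omega>) | k i. 1 \<le> k \<and> k < t \<and> i \<in> units E k})"

text \<open>
  The number of stages is a stopping time: whether stage \<open>t + 1\<close> is run is decided on the basis of
  the observations up to stage \<open>t\<close>.  The last clause says that, given the potential outcomes and the
  past assignments, the treatment group is uniform on the subsets of size \<open>tsize E t \<omega>\<close>.
\<close>
definition randomised_experiment :: "'a measure \<Rightarrow> ('a, 'u) trial \<Rightarrow> bool" where
  "randomised_experiment M E \<longleftrightarrow>
     stopping_time (history M E) (stages E) \<and>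
     (\<forall>t\<ge>1.
        finite (units E t) \<and>
        (\<forall>i\<in>units E t. \<forall>w\<in>{0, 1}. outcome E w t i \<in> borel_measurable M) \<and>
        treated E t \<in> measurable M (count_space (Pow (units E t))) \<and>
        tsize E t \<in> measurable (history M E (t - 1)) (count_space UNIV) \<and>
        (\<forall>\<omega>\<in>space M. t \<le> stages E \<omega> \<longrightarrow> card (treated E t \<omega>) = tsize E t \<omega>) \<and>
        (\<forall>S\<subseteq>units E t. AE \<omega> in M. t \<le> stages E \<omega> \<longrightarrow>
           real_cond_exp M (pre_assignment M E t)
             (indicator {\<omega>\<in>space M. treated E t \<omega> = S}) \<omega> =
           (if card S = tsize E t \<omega> then 1 / real (card (units E t) choose tsize E t \<omega>) else 0)))"

definition RRC :: "'a measure \<Rightarrow> ('a, 'u) trial \<Rightarrow> real \<Rightarrow> real \<Rightarrow> bool" where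
  "RRC M E \<delta> B \<longleftrightarrow> measure M {\<omega>\<in>space M. total_cost E (stages E \<omega>) \<omega> > B} \<ge> 1 - \<delta>"

section \<open>The algorithm\<close>

definition \<Phi> :: "real \<Rightarrow> real" where
  "\<Phi> = cdf std_normal_distribution"

definition \<Phi>_inv :: "real \<Rightarrow> ereal" where
  "\<Phi>_inv p = (if p \<le> 0 then -\<infinity> else if p \<ge> 1 then \<infinity> else ereal (THE x. \<Phi> x = p))"

definition post_var :: "('a, 'u) trial \<Rightarrow> nat \<Rightarrow> nat \<Rightarrow> 'a \<Rightarrow> real" where
  "post_var E w t \<omega> =
     inverse (1 / prior_var E w + real (cum_size E w (t - 1) \<omega>) / data_var E w t \<omega>)"

definition post_mean :: "('a, 'u) trial \<Rightarrow> nat \<Rightarrow> nat \<Rightarrow> 'a \<Rightarrow> real" where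
  "post_mean E w t \<omega> = post_var E w t \<omega> *
     (prior_mean E w / prior_var E w +
      (if w = 1 then ST E 1 (t - 1) \<omega> else SC E 0 (t - 1) \<omega>) / data_var E w t \<omega>)"

definition mu_tilde :: "('a, 'u) trial \<Rightarrow> nat \<Rightarrow> 'a \<Rightarrow> real \<Rightarrow> real" where
  "mu_tilde E t \<omega> m =
     post_mean E 1 t \<omega> * m - post_mean E 0 t \<omega> * (m + real (cum_size E 1 (t - 1) \<omega>))"

definition sigma_tilde :: "('a, 'u) trial \<Rightarrow> nat \<Rightarrow> 'a \<Rightarrow> real \<Rightarrow> real" where
  "sigma_tilde E t \<omega> m = (let n = m + real (cum_size E 1 (t - 1) \<omega>) in
     sqrt (m\<^sup>2 * post_var E 1 t \<omega> + m * data_var E 1 t \<omega>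
           + n\<^sup>2 * post_var E 0 t \<omega> + n * data_var E 0 t \<omega>))"

text \<open>With \<open>m = tsize E t \<omega>\<close> this is $z_t$.\<close>
definition z_score :: "('a, 'u) trial \<Rightarrow> nat \<Rightarrow> 'a \<Rightarrow> real \<Rightarrow> real" where
  "z_score E t \<omega> m = (bound E t \<omega> - ST E 1 (t - 1) \<omega> - mu_tilde E t \<omega> m) / sigma_tilde E t \<omega> m"

text \<open>
  If $\Delta_t = 0$, then $q_t = -\infty$ and \<open>Q\<close> is a dummy; no \<open>m\<close> passes the test
  \<open>z_score E t \<omega> m \<le> q\<close> then, so the result is 0 whatever \<open>Q\<close> is.  If $A_t = 0$, the two quotients
  are 0 by the convention \<open>x / 0 = 0\<close>, and the last case gives 0 as well.
\<close>
definition algorithm_size :: "('a, 'u) trial \<Rightarrow> nat \<Rightarrow> 'a \<Rightarrow> nat" where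
  "algorithm_size E t \<omega> =
    (let N = card (units E t);
         M1 = real (cum_size E 1 (t - 1) \<omega>);
         q = \<Phi>_inv (risk E t \<omega>);
         Q = (real_of_ereal q)\<^sup>2;
         d = post_mean E 1 t \<omega> - post_mean E 0 t \<omega>;
         g = bound E t \<omega> - ST E 1 (t - 1) \<omega> + post_mean E 0 t \<omega> * M1;
         a = Q * (post_var E 1 t \<omega> + post_var E 0 t \<omega>) - d\<^sup>2;
         b = Q * (data_var E 1 t \<omega> + data_var E 0 t \<omega> + 2 * post_var E 0 t \<omega> * M1) + 2 * g * d;
         c = Q * post_var E 0 t \<omega> * M1\<^sup>2 + Q * data_var E 0 t \<omega> * M1 - g\<^sup>2;
         D = b\<^sup>2 - 4 * a * c;
         \<M> = {\<lfloor>(- b + sqrt D) / (2 * a)\<rfloor>, \<lfloor>(- b - sqrt D) / (2 * a)\<rfloor>};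
         \<V> = {m \<in> \<M>. 0 \<le> m \<and> real_of_int m \<le> real N / 2
                     \<and> ereal (z_score E t \<omega> (real_of_int m)) \<le> q}
     in if ereal (z_score E t \<omega> (real (N div 2))) \<le> q then N div 2
        else if D < 0 then 0
        else if \<V> \<noteq> {} then nat (Max \<V>)
        else 0)"

definition survival_budget :: "('a, 'u) trial \<Rightarrow> nat \<Rightarrow> 'a \<Rightarrow> real" where
  "survival_budget E t \<omega> = (\<Prod>k=1..t. 1 - risk E k \<omega>)"

text \<open>
  The variance of arm \<open>w\<close> is either known, i.e. one fixed number at all stages, or it is
  estimated.  The sample variance needs two observations, and \<open>data_var\<close> must be positive for the
  formulas to make sense; in stages where the sample variance is undefined or 0 (which includes
  stage 1), any positive value determined by the past may be used.
\<close>
definition variance_rule :: "'a measure \<Rightarrow> ('a, 'u) trial \<Rightarrow> nat \<Rightarrow> bool" where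
  "variance_rule M E w \<longleftrightarrow>
     (\<forall>t\<ge>1. data_var E w t \<in> borel_measurable (history M E (t - 1))) \<and>
     (\<forall>\<omega>\<in>space M. \<forall>t. 1 \<le> t \<and> t \<le> stages E \<omega> \<longrightarrow> data_var E w t \<omega> > 0) \<and>
     ((\<exists>c. \<forall>\<omega>\<in>space M. \<forall>t. 1 \<le> t \<and> t \<le> stages E \<omega> \<longrightarrow> data_var E w t \<omega> = c) \<or>
      (\<forall>\<omega>\<in>space M. \<forall>t. 2 \<le> t \<and> t \<le> stages E \<omega> \<and>
          cum_size E w (t - 1) \<omega> \<ge> 2 \<and> sample_var E w (t - 1) \<omega> > 0 \<longrightarrow>
          data_var E w t \<omega> = sample_var E w (t - 1) \<omega>))"

text \<open>
  The loop condition is required at every stage that is run, so the experiment stops at the latest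
  when the loop ends; it may also be stopped earlier, e.g. at a fixed horizon.
\<close>
definition follows_algorithm ::
    "'a measure \<Rightarrow> ('a, 'u) trial \<Rightarrow> real \<Rightarrow> real \<Rightarrow> bool" where
  "follows_algorithm M E \<delta> B \<longleftrightarrow>
     (\<forall>w\<in>{0, 1}. prior_var E w > 0 \<and> variance_rule M E w) \<and>
     (\<forall>t\<ge>1. risk E t \<in> borel_measurable (history M E (t - 1)) \<and>
             bound E t \<in> borel_measurable (history M E (t - 1))) \<and>
     (\<forall>\<omega>\<in>space M. \<forall>t. 1 \<le> t \<and> t \<le> stages E \<omega> \<longrightarrow>
        survival_budget E (t - 1) \<omega> > 1 - \<delta> \<and>
        risk E t \<omega> \<in> {0 .. 1 - (1 - \<delta>) / survival_budget E (t - 1) \<omega>} \<and>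
        bound E t \<omega> \<ge> B \<and>
        tsize E t \<omega> = algorithm_size E t \<omega>)"

section \<open>Conditional moments\<close>

text \<open>
  \<^const>\<open>real_cond_exp\<close> takes the difference of the conditional expectations of the positive and the
  negative part, so it is the (generalised) conditional expectation as soon as these are finite.
\<close>

definition cond_var :: "'a measure \<Rightarrow> 'a measure \<Rightarrow> ('a \<Rightarrow> real) \<Rightarrow> 'a \<Rightarrow> real" where
  "cond_var M F X = real_cond_exp M F (\<lambda>\<omega>. (X \<omega> - real_cond_exp M F X \<omega>)\<^sup>2)"

definition cond_probability :: "'a measure \<Rightarrow> 'a measure \<Rightarrow> ('a \<Rightarrow> bool) \<Rightarrow> 'a \<Rightarrow> real" where
  "cond_probability M F P = real_cond_exp M F (indicator {\<omega>\<in>space M. P \<omega>})"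

definition gap :: "('a, 'u) trial \<Rightarrow> nat \<Rightarrow> 'a \<Rightarrow> real" where
  "gap E t \<omega> = sT E 1 t \<omega> - ST E 0 t \<omega>"

definition mu_breve :: "'a measure \<Rightarrow> ('a, 'u) trial \<Rightarrow> nat \<Rightarrow> 'a \<Rightarrow> real" where
  "mu_breve M E t = real_cond_exp M (history M E (t - 1)) (gap E t)"

definition sigma_breve :: "'a measure \<Rightarrow> ('a, 'u) trial \<Rightarrow> nat \<Rightarrow> 'a \<Rightarrow> real" where
  "sigma_breve M E t \<omega> = sqrt (cond_var M (history M E (t - 1)) (gap E t) \<omega>)"

end

theory Submission
  imports Defs
begin

text \<open>
  The event $R_{t-1} > B$ involves unobserved outcomes and so does not lie in $\mathcal F_{t-1}$;
  hence the survival probabilities cannot simply be multiplied along the stages.  Instead,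
  $V_t = \mathbf 1\{R_t > B\} / \prod_{k \le t} (1 - \Delta_k)$, stopped at $T$, has nondecreasing
  expectation: if $m_t = 0$, then $R_t = R_{t-1}$ and the denominator does not grow; if $m_t \neq 0$,
  the test passed by $m_t$ and the two conditions give
  $\mathbb P(R_t > B \mid \mathcal F_{t-1}) \ge 1 - \Delta_t$, and already
  $V_{t-1} \le 1 / \prod_{k < t} (1 - \Delta_k)$.  As $V_0 = 1$ and
  $V_t \le \mathbf 1\{R_t > B\} / (1 - \delta)$, this yields
  $\mathbb P(R_{\min(n, T)} > B) \ge 1 - \delta$ for all $n$, and $n \to \infty$ gives the claim.
\<close>

section \<open>The standard normal distribution function\<close>

text \<open>A measure with a Lebesgue density has no atoms, and continuity of a distribution
  function at \<open>x\<close> amounts to \<open>{x}\<close> being null.\<close>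

lemma isCont_\<Phi>: "isCont \<Phi> x"
proof -
  interpret real_distribution std_normal_distribution
    by (rule real_dist_normal_dist)
  have "AE z in lborel. z \<in> {x} \<longrightarrow> ennreal (std_normal_density z) = 0"
    using AE_lborel_singleton[of x] by eventually_elim simp
  then have "{x} \<in> null_sets std_normal_distribution"
    by (subst null_sets_density_iff; simp)
  then show ?thesis
    unfolding \<Phi>_def isCont_cdf by (simp add: measure_eq_0_null_sets)
qed

text \<open>The density is positive everywhere, so an interval of positive length cannot be
  null.\<close>

lemma strict_mono_\<Phi>: "strict_mono \<Phi>"
proof (rule strict_monoI)
  fix x y :: real
  assume "x < y"
  interpret real_distribution std_normal_distribution
    by (rule real_dist_normal_dist)
  have "measure std_normal_distribution {x<..y} \<noteq> 0"
  proof
    assume "measure std_normal_distribution {x<..y} = 0"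
    then have "{x<..y} \<in> null_sets std_normal_distribution"
      by (intro null_setsI) (auto simp: emeasure_eq_measure)
    then have "AE z in lborel. z \<in> {x<..y} \<longrightarrow> ennreal (std_normal_density z) = 0"
      by (simp add: null_sets_density_iff del: ennreal_eq_0_iff)
    then have "AE z in lborel. z \<notin> {x<..y}"
      by eventually_elim (metis ennreal_eq_0_iff normal_density_pos not_less zero_less_one)
    then have "emeasure lborel {x<..y} = 0"
      by (subst (asm) AE_iff_measurable[where N = "{x<..y}"]) auto
    with \<open>x < y\<close> show False
      by simp
  qed
  then have "0 < measure std_normal_distribution {x<..y}"
    by (simp add: zero_less_measure_iff)
  with cdf_diff_eq[OF \<open>x < y\<close>] show "\<Phi> x < \<Phi> y"
    by (simp add: \<Phi>_def)
qed

text \<open>The limits 0 and 1 together with continuity give a preimage by the intermediate value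
  theorem. Strict monotonicity makes it unique, so the definite description in
  \<open>\<Phi>_inv\<close> denotes it.\<close>

lemma \<Phi>_\<Phi>_inv:
  assumes "0 < p" "p < 1"
  obtains x where "\<Phi>_inv p = ereal x" "\<Phi> x = p"
proof -
  interpret real_distribution std_normal_distribution
    by (rule real_dist_normal_dist)
  have "eventually (\<lambda>x. \<Phi> x < p) at_bot" "eventually (\<lambda>x. p < \<Phi> x) at_top"
    using order_tendstoD(2)[OF cdf_lim_at_bot \<open>0 < p\<close>]
      order_tendstoD(1)[OF cdf_lim_at_top_prob \<open>p < 1\<close>] by (simp_all add: \<Phi>_def)
  then obtain l u where lu: "\<Phi> l < p" "p < \<Phi> u"
    by (auto simp: eventually_at_bot_linorder eventually_at_top_linorder)
  then have "l \<le> u"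
    using strict_mono_less[OF strict_mono_\<Phi>, of l u] by linarith
  then obtain x where x: "\<Phi> x = p"
    using IVT[of \<Phi> l p u] lu isCont_\<Phi> by fastforce
  then have "(THE x. \<Phi> x = p) = x"
    using strict_mono_eq[OF strict_mono_\<Phi>] by blast
  with x assms that show ?thesis
    by (simp add: \<Phi>_inv_def)
qed

text \<open>Turns the algorithm's test into a probability bound. A real \<open>z\<close> is never
  below the value at risk 0, which is minus infinity, and \<open>p < 1\<close> excludes the value
  plus infinity; in between, \<open>\<Phi>\<close> is monotone.\<close>

lemma \<Phi>_le_if_le_\<Phi>_inv:
  assumes "ereal z \<le> \<Phi>_inv p" "p < 1"
  shows "\<Phi> z \<le> p"
proof -
  have "0 < p"
    using assms by (auto simp: \<Phi>_inv_def split: if_splits)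
  then obtain x where "\<Phi>_inv p = ereal x" "\<Phi> x = p"
    using \<Phi>_\<Phi>_inv \<open>p < 1\<close> by blast
  with assms show ?thesis
    using strict_mono_less_eq[OF strict_mono_\<Phi>, of z x] by simp
qed

section \<open>The chosen size passes the test\<close>

text \<open>A nonzero size is either half of the units, accepted by the test, or the maximum of a
  finite set of candidates that all passed it. The value 0 is excluded because it is also the
  fallback when nothing passes.\<close>

lemma z_score_algorithm_size:
  assumes "algorithm_size E t \<omega> \<noteq> 0"
  shows "ereal (z_score E t \<omega> (real (algorithm_size E t \<omega>))) \<le> \<Phi>_inv (risk E t \<omega>)"
proof -
  define good where "good m \<longleftrightarrow> ereal (z_score E t \<omega> m) \<le> \<Phi>_inv (risk E t \<omega>)" for m
  \<comment> \<open>The case distinction is treated for arbitrary \<open>N\<close>,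
    \<open>D\<close>, \<open>k\<close>, \<open>l\<close>, so the formulas for the roots never have
    to be simplified; the instance is then found by unfolding and reflexivity.\<close>
  have choice: "good (real s)"
    if "s = (if good (real (N div 2)) then N div 2 else if D < 0 then 0
          else if {m \<in> {k, l}. 0 \<le> m \<and> real_of_int m \<le> real N / 2 \<and> good (real_of_int m)} \<noteq> {}
          then nat (Max {m \<in> {k, l}. 0 \<le> m \<and> real_of_int m \<le> real N / 2 \<and> good (real_of_int m)})
          else 0)" (is "s = (if _ then _ else if _ then _ else if ?V \<noteq> {} then nat (Max ?V) else 0)")
      and "s \<noteq> 0" for s N :: nat and D :: real and k l :: int
  proof (cases "good (real (N div 2))")
    case False
    with that have V: "?V \<noteq> {}" and s: "s = nat (Max ?V)"
      by (auto split: if_splits)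
    \<comment> \<open>Membership also yields \<open>0 \<le> Max ?V\<close>, so the conversion by
      \<open>nat\<close> loses nothing.\<close>
    have "Max ?V \<in> ?V"
      using V by (intro Max_in) auto
    with s show ?thesis
      by simp
  qed (use that in simp)
  show ?thesis
    unfolding good_def[symmetric]
    by (rule choice[OF _ assms]) (unfold algorithm_size_def Let_def good_def, rule refl)
qed

section \<open>Measurability\<close>

lemma space_generated_by [simp]: "space (generated_by M \<X>) = space M"
  by (simp add: generated_by_def space_measure_of_conv)

lemma sets_generated_by:
  "sets (generated_by M \<X>) = sigma_sets (space M) {X -` A \<inter> space M | X A. X \<in> \<X> \<and> A \<in> sets borel}"
  unfolding generated_by_def by (rule sets_measure_of) auto

lemma subalgebra_generated_by:
  assumes "\<X> \<subseteq> borel_measurable M"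
  shows "subalgebra M (generated_by M \<X>)"
  unfolding subalgebra_def sets_generated_by
  using assms by (auto intro!: sets.sigma_sets_subset measurable_sets)

lemma subalgebra_generated_by_mono:
  assumes "\<X> \<subseteq> \<Y>"
  shows "subalgebra (generated_by M \<Y>) (generated_by M \<X>)"
  unfolding subalgebra_def sets_generated_by
  using assms by (auto intro!: sigma_sets_mono')

lemma subalgebra_history_mono:
  assumes "s \<le> t"
  shows "subalgebra (history M E t) (history M E s)"
  unfolding history_def by (rule subalgebra_generated_by_mono) (use assms in fastforce)

text \<open>A sum over a random subset of a finite set \<open>U\<close> is a sum over all of
  \<open>U\<close> in which the terms outside the subset are set to 0.\<close>

lemma borel_measurable_sum_random_set:
  fixes f :: "'u \<Rightarrow> 'a \<Rightarrow> real"
  assumes A: "A \<in> measurable M (count_space (Pow U))" and "finite U"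
    and f: "\<And>i. i \<in> U \<Longrightarrow> f i \<in> borel_measurable M"
  shows "(\<lambda>\<omega>. \<Sum>i\<in>A \<omega>. f i \<omega>) \<in> borel_measurable M"
proof -
  have "(\<lambda>\<omega>. \<Sum>i\<in>U. if i \<in> A \<omega> then f i \<omega> else 0) \<in> borel_measurable M"
  proof (intro borel_measurable_sum measurable_If f)
    fix i
    show "{\<omega> \<in> space M. i \<in> A \<omega>} \<in> sets M"
      using measurable_compose[OF A measurable_count_space, of "\<lambda>S. i \<in> S"] by simp
  qed auto
  moreover have "(\<Sum>i\<in>U. if i \<in> A \<omega> then f i \<omega> else 0) = (\<Sum>i\<in>A \<omega>. f i \<omega>)" if "\<omega> \<in> space M" for \<omega>
  proof -
    have "A \<omega> \<subseteq> U"
      using measurable_space[OF A that] by auto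
    then show ?thesis
      using \<open>finite U\<close> by (simp add: sum.If_cases Int_absorb1)
  qed
  ultimately show ?thesis
    by (simp cong: measurable_cong)
qed

section \<open>Processes of the experiment\<close>

lemma randomised_experimentD:
  assumes "randomised_experiment M E" "1 \<le> t"
  shows "finite (units E t)"
    and "i \<in> units E t \<Longrightarrow> outcome E 0 t i \<in> borel_measurable M"
    and "i \<in> units E t \<Longrightarrow> outcome E 1 t i \<in> borel_measurable M"
    and "treated E t \<in> measurable M (count_space (Pow (units E t)))"
    and "tsize E t \<in> measurable (history M E (t - 1)) (count_space UNIV)"
    and "\<omega> \<in> space M \<Longrightarrow> t \<le> stages E \<omega> \<Longrightarrow> card (treated E t \<omega>) = tsize E t \<omega>"
  using assms unfolding randomised_experiment_def by auto

lemma measurable_treated_unit: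
  assumes "randomised_experiment M E" "1 \<le> t"
  shows "Measurable.pred M (\<lambda>\<omega>. i \<in> treated E t \<omega>)"
  using measurable_compose[OF randomised_experimentD(4)[OF assms] measurable_count_space, of "\<lambda>S. i \<in> S"]
  by simp

lemma subalgebra_history:
  assumes "randomised_experiment M E"
  shows "subalgebra M (history M E t)"
  unfolding history_def
proof (intro subalgebra_generated_by UN_least)
  fix k i
  assume "k \<in> {1..t}" and i: "i \<in> units E k"
  then have k: "1 \<le> k"
    by simp
  note [measurable] = measurable_treated_unit[OF assms k, of i]
    randomised_experimentD(2,3)[OF assms k i]
  have "(\<lambda>\<omega>. real (W E k i \<omega>)) \<in> borel_measurable M"
    unfolding W_def by measurable
  \<comment> \<open>In \<open>observed\<close> the arm is itself random; written as a case
    distinction on membership in the treatment group, it involves only fixed measurable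
    outcomes.\<close>
  moreover have "(\<lambda>\<omega>. if i \<in> treated E k \<omega> then outcome E 1 k i \<omega> else outcome E 0 k i \<omega>)
      \<in> borel_measurable M"
    by measurable
  then have "observed E k i \<in> borel_measurable M"
    by (rule measurable_cong[THEN iffD1, rotated]) (simp add: observed_def W_def)
  ultimately show "{\<lambda>\<omega>. real (W E k i \<omega>), observed E k i} \<subseteq> borel_measurable M"
    by simp
qed

lemma measurable_sT:
  assumes "randomised_experiment M E" "1 \<le> t" "w \<in> {0, 1}"
  shows "sT E w t \<in> borel_measurable M"
  unfolding sT_def using assms(3)
  by (intro borel_measurable_sum_random_set[OF randomised_experimentD(4,1)[OF assms(1,2)]])
    (auto simp: randomised_experimentD(2)[OF assms(1,2)] randomised_experimentD(3)[OF assms(1,2), simplified])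

lemma measurable_ST:
  assumes "randomised_experiment M E" "w \<in> {0, 1}"
  shows "ST E w t \<in> borel_measurable M"
  unfolding ST_def by (intro borel_measurable_sum measurable_sT assms) auto

lemma measurable_SC_0:
  assumes "randomised_experiment M E"
  shows "SC E 0 t \<in> borel_measurable M"
  unfolding SC_def
proof (rule borel_measurable_sum)
  fix k
  assume "k \<in> {1..t}"
  then have k: "1 \<le> k"
    by simp
  have "control E k \<in> measurable M (count_space (Pow (units E k)))"
    unfolding control_def
    by (rule measurable_compose[OF randomised_experimentD(4)[OF assms k]]) auto
  then show "sC E 0 k \<in> borel_measurable M"
    unfolding sC_def
    by (rule borel_measurable_sum_random_set[OF _ randomised_experimentD(1,2)[OF assms k]])
qed

lemma measurable_tsize:
  assumes "randomised_experiment M E" "1 \<le> t"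
  shows "tsize E t \<in> measurable M (count_space UNIV)"
  using measurable_from_subalg[OF subalgebra_history randomised_experimentD(5)] assms by blast

lemma measurable_cum_size:
  assumes "randomised_experiment M E"
  shows "(\<lambda>\<omega>. real (cum_size E w t \<omega>)) \<in> borel_measurable M"
  unfolding cum_size_def of_nat_sum
proof (rule borel_measurable_sum)
  fix k
  assume "k \<in> {1..t}"
  then have "tsize E k \<in> measurable M (count_space UNIV)"
    using measurable_tsize[OF assms] by simp
  then show "(\<lambda>\<omega>. real (if w = 1 then tsize E k \<omega> else card (units E k) - tsize E k \<omega>))
      \<in> borel_measurable M"
    by (rule measurable_compose) simp
qed

lemma total_cost_eq: "total_cost E t \<omega> = ST E 1 t \<omega> - ST E 0 t \<omega>"
  by (simp add: total_cost_def stage_cost_def ST_def sT_def sum_subtractf)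

text \<open>Separates the treated outcomes already observed before stage \<open>t\<close> from
  \<open>gap\<close>, which holds the new treated outcomes and all the unobserved control outcomes
  of treated units. This explains the threshold in the numerator of \<open>z_score\<close>.\<close>

lemma total_cost_eq_gap:
  assumes "1 \<le> t"
  shows "total_cost E t \<omega> = ST E 1 (t - 1) \<omega> + gap E t \<omega>"
  using assms by (cases t) (auto simp: total_cost_eq gap_def ST_def)

lemma measurable_total_cost:
  assumes "randomised_experiment M E"
  shows "total_cost E t \<in> borel_measurable M"
proof -
  note [measurable] = measurable_ST[OF assms]
  show ?thesis
    unfolding total_cost_eq by measurable
qed

lemma follows_algorithmD:
  assumes "follows_algorithm M E \<delta> B" "1 \<le> t"
  shows "risk E t \<in> borel_measurable (history M E (t - 1))"
    and "bound E t \<in> borel_measurable (history M E (t - 1))"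
    and "w \<in> {0, 1} \<Longrightarrow> data_var E w t \<in> borel_measurable (history M E (t - 1))"
    and "\<omega> \<in> space M \<Longrightarrow> t \<le> stages E \<omega> \<Longrightarrow> survival_budget E (t - 1) \<omega> > 1 - \<delta>"
    and "\<omega> \<in> space M \<Longrightarrow> t \<le> stages E \<omega> \<Longrightarrow> 0 \<le> risk E t \<omega>"
    and "\<omega> \<in> space M \<Longrightarrow> t \<le> stages E \<omega> \<Longrightarrow>
      risk E t \<omega> \<le> 1 - (1 - \<delta>) / survival_budget E (t - 1) \<omega>"
    and "\<omega> \<in> space M \<Longrightarrow> t \<le> stages E \<omega> \<Longrightarrow> B \<le> bound E t \<omega>"
    and "\<omega> \<in> space M \<Longrightarrow> t \<le> stages E \<omega> \<Longrightarrow> tsize E t \<omega> = algorithm_size E t \<omega>"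
  using assms unfolding follows_algorithm_def variance_rule_def by auto

text \<open>Measurability with respect to \<open>M\<close> suffices: the score enters the event of
  the tail condition, and otherwise only pointwise bounds.\<close>

lemma measurable_z_score:
  assumes "randomised_experiment M E" "follows_algorithm M E \<delta> B" "1 \<le> t"
  shows "(\<lambda>\<omega>. z_score E t \<omega> (real (tsize E t \<omega>))) \<in> borel_measurable M"
proof -
  note from_history = measurable_from_subalg[OF subalgebra_history[OF assms(1)]]
  have [measurable]: "data_var E 0 t \<in> borel_measurable M" "data_var E 1 t \<in> borel_measurable M"
    "bound E t \<in> borel_measurable M"
    using follows_algorithmD(2,3)[OF assms(2,3)] by (auto intro: from_history)
  have [measurable]: "ST E 1 (t - 1) \<in> borel_measurable M"
    by (rule measurable_ST[OF assms(1)]) simp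
  note [measurable] = measurable_SC_0[OF assms(1)]
    measurable_cum_size[OF assms(1)] measurable_tsize[OF assms(1,3)]
  show ?thesis
    unfolding z_score_def mu_tilde_def sigma_tilde_def post_mean_def post_var_def Let_def
    by measurable
qed

section \<open>Survival\<close>

lemma survival_budget_0 [simp]: "survival_budget E 0 \<omega> = 1"
  by (simp add: survival_budget_def)

lemma survival_budget_Suc [simp]:
  "survival_budget E (Suc t) \<omega> = survival_budget E t \<omega> * (1 - risk E (Suc t) \<omega>)"
  by (simp add: survival_budget_def mult.commute)

text \<open>The upper limit imposed on the latest risk is exactly what keeps the product from
  falling below \<open>1 - \<delta>\<close>; earlier stages matter only through positivity of the
  previous budget.\<close>

lemma survival_budget_ge:
  assumes "follows_algorithm M E \<delta> B" "\<omega> \<in> space M" "t \<le> stages E \<omega>" "0 \<le> \<delta>" "\<delta> < 1"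
  shows "1 - \<delta> \<le> survival_budget E t \<omega>"
proof (cases t)
  case (Suc s)
  then have "1 \<le> t" "t - 1 = s"
    by simp_all
  then have "1 - \<delta> < survival_budget E s \<omega>" "(1 - \<delta>) / survival_budget E s \<omega> \<le> 1 - risk E t \<omega>"
    using follows_algorithmD(4,6)[OF assms(1) \<open>1 \<le> t\<close> assms(2,3)] by simp_all
  then show ?thesis
    using Suc \<open>\<delta> < 1\<close> by (simp add: divide_le_eq mult.commute)
qed (use assms in simp)

text \<open>The index is \<open>t - 1\<close> although the product includes the risk of stage
  \<open>t\<close>, because that risk is chosen before the stage is run.\<close>

lemma measurable_survival_budget:
  assumes "follows_algorithm M E \<delta> B"
  shows "survival_budget E t \<in> borel_measurable (history M E (t - 1))"
  unfolding survival_budget_def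
proof (intro borel_measurable_prod borel_measurable_diff borel_measurable_const)
  fix k
  assume "k \<in> {1..t}"
  then show "risk E k \<in> borel_measurable (history M E (t - 1))"
    by (intro measurable_from_subalg[OF subalgebra_history_mono follows_algorithmD(1)[OF assms]]) auto
qed

lemma total_cost_tsize_0:
  assumes "randomised_experiment M E" "\<omega> \<in> space M" "Suc t \<le> stages E \<omega>" "tsize E (Suc t) \<omega> = 0"
  shows "total_cost E (Suc t) \<omega> = total_cost E t \<omega>"
proof -
  have "treated E (Suc t) \<omega> \<in> space (count_space (Pow (units E (Suc t))))"
    by (rule measurable_space[OF randomised_experimentD(4)[OF assms(1)] assms(2)]) simp
  \<comment> \<open>Finiteness has to be known first, since \<open>card\<close> is 0 on infinite
    sets as well.\<close>
  then have "finite (treated E (Suc t) \<omega>)"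
    using randomised_experimentD(1)[OF assms(1), of "Suc t"] by (simp add: finite_subset)
  moreover have "card (treated E (Suc t) \<omega>) = 0"
    using randomised_experimentD(6)[OF assms(1), of "Suc t" \<omega>] assms by simp
  ultimately have "treated E (Suc t) \<omega> = {}"
    by simp
  then show ?thesis
    by (simp add: total_cost_def stage_cost_def)
qed

section \<open>Ruin at a single stage\<close>

lemma standardised_gap_le:
  fixes \<mu>' \<sigma>' \<mu> \<sigma> \<beta> g :: real
  assumes "0 < \<sigma>'" "\<sigma>' < \<sigma>" "(\<beta> - \<mu>) / \<sigma> \<le> (\<mu>' - \<mu>) / (\<sigma> - \<sigma>')" "g \<le> \<beta>"
  shows "(g - \<mu>') / \<sigma>' \<le> (\<beta> - \<mu>) / \<sigma>"
proof -
  define z where "z = (\<beta> - \<mu>) / \<sigma>"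
  have "\<beta> - \<mu> = z * \<sigma>"
    using assms by (simp add: z_def)
  moreover have "z * (\<sigma> - \<sigma>') \<le> \<mu>' - \<mu>"
    using assms by (simp add: z_def[symmetric] pos_le_divide_eq)
  ultimately have "g - \<mu>' \<le> z * \<sigma>'"
    using \<open>g \<le> \<beta>\<close> by (simp add: algebra_simps)
  then show ?thesis
    using \<open>0 < \<sigma>'\<close> by (simp add: z_def[symmetric] pos_divide_le_eq)
qed

text \<open>The factors are controlled only on \<open>G\<close>; at stages that are not run they may
  be dummies of any size, and the indicator removes them.\<close>

lemma (in finite_measure) integrable_mult_bounded_on:
  fixes f g :: "'a \<Rightarrow> real"
  assumes [measurable]: "G \<in> sets M" "f \<in> borel_measurable M" "g \<in> borel_measurable M"
    and f: "\<And>\<omega>. \<omega> \<in> G \<Longrightarrow> \<bar>f \<omega>\<bar> \<le> K" and g: "\<And>\<omega>. \<omega> \<in> G \<Longrightarrow> \<bar>g \<omega>\<bar> \<le> 1"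
  shows "integrable M (\<lambda>\<omega>. indicator G \<omega> * f \<omega> * g \<omega>)"
proof (rule integrable_const_bound)
  have "\<bar>f \<omega>\<bar> * \<bar>g \<omega>\<bar> \<le> \<bar>K\<bar> * 1" if "\<omega> \<in> G" for \<omega>
    using f[OF that] g[OF that] by (intro mult_mono) auto
  then show "AE \<omega> in M. norm (indicator G \<omega> * f \<omega> * g \<omega>) \<le> \<bar>K\<bar>"
    by (intro AE_I2) (auto simp: indicator_def abs_mult)
qed measurable

text \<open>Integrated form of the statement that, given the past, ruin after an active stage has
  probability at most the chosen risk. Ruin implies the event of the tail condition, whose
  conditional probability is at most \<open>\<Phi>\<close> of the score, and the passed test bounds
  this by the risk. The weight \<open>f\<close> leaves room for the reciprocal survival
  budget.\<close>

lemma (in prob_space) cond_ruin_le_risk: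
  fixes E :: "('a, 'u) trial"
  assumes RE: "randomised_experiment M E" and FA: "follows_algorithm M E \<delta> B"
    and \<delta>: "0 \<le> \<delta>" "\<delta> < 1" and t: "1 \<le> t"
    and quotients_meaningful: "AE \<omega> in M. t \<le> stages E \<omega> \<and> tsize E t \<omega> \<noteq> 0 \<longrightarrow>
           0 < sigma_breve M E t \<omega> \<and> sigma_breve M E t \<omega> < sigma_tilde E t \<omega> (real (tsize E t \<omega>))"
    and tail_condition: "AE \<omega> in M. t \<le> stages E \<omega> \<and> tsize E t \<omega> \<noteq> 0 \<longrightarrow>
           cond_probability M (history M E (t - 1))
             (\<lambda>\<omega>. (sT E 1 t \<omega> - ST E 0 t \<omega> - mu_breve M E t \<omega>) / sigma_breve M E t \<omega>
                    \<le> z_score E t \<omega> (real (tsize E t \<omega>))) \<omega>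
           \<le> \<Phi> (z_score E t \<omega> (real (tsize E t \<omega>)))"
    and z_condition: "AE \<omega> in M. t \<le> stages E \<omega> \<and> tsize E t \<omega> \<noteq> 0 \<longrightarrow>
           z_score E t \<omega> (real (tsize E t \<omega>))
           \<le> (mu_breve M E t \<omega> - mu_tilde E t \<omega> (real (tsize E t \<omega>)))
               / (sigma_tilde E t \<omega> (real (tsize E t \<omega>)) - sigma_breve M E t \<omega>)"
    and G: "G \<in> sets (history M E (t - 1))"
      "\<And>\<omega>. \<omega> \<in> G \<Longrightarrow> t \<le> stages E \<omega> \<and> tsize E t \<omega> \<noteq> 0"
    and f: "f \<in> borel_measurable (history M E (t - 1))"
      "\<And>\<omega>. \<omega> \<in> G \<Longrightarrow> 0 \<le> f \<omega>" "\<And>\<omega>. \<omega> \<in> G \<Longrightarrow> f \<omega> \<le> K"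
  shows "(\<integral>\<omega>. indicator G \<omega> * f \<omega> * indicator {\<omega>\<in>space M. total_cost E t \<omega> \<le> B} \<omega> \<partial>M)
    \<le> (\<integral>\<omega>. indicator G \<omega> * f \<omega> * risk E t \<omega> \<partial>M)"
proof -
  define F where "F = history M E (t - 1)"
  have sub: "subalgebra M F"
    unfolding F_def by (rule subalgebra_history[OF RE])
  interpret F: finite_measure_subalgebra M F
    by unfold_locales (rule sub)
  note from_F = measurable_from_subalg[OF sub]
  note [measurable] = G(1)[folded F_def] f(1)[folded F_def]
  have [measurable]: "G \<in> sets M" "f \<in> borel_measurable M" "risk E t \<in> borel_measurable M"
    using sub G(1) from_F f(1) follows_algorithmD(1)[OF FA t]
    by (auto simp: F_def subalgebra_def)
  have [measurable]: "mu_breve M E t \<in> borel_measurable M" "sigma_breve M E t \<in> borel_measurable M"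
    unfolding mu_breve_def sigma_breve_def cond_var_def by measurable
  have [measurable]: "gap E t \<in> borel_measurable M"
    using measurable_sT[OF RE t, of 1] measurable_ST[OF RE, of 0] unfolding gap_def by simp
  note [measurable] = measurable_z_score[OF RE FA t] measurable_total_cost[OF RE]
  define A where "A = {\<omega>\<in>space M. (gap E t \<omega> - mu_breve M E t \<omega>) / sigma_breve M E t \<omega>
                    \<le> z_score E t \<omega> (real (tsize E t \<omega>))}"
  have [measurable]: "A \<in> sets M"
    unfolding A_def by measurable
  define h where "h \<omega> = indicator G \<omega> * f \<omega>" for \<omega>
  have h: "0 \<le> h \<omega>" for \<omega>
    using f(2)[of \<omega>] by (simp add: h_def indicator_def)
  have [measurable]: "h \<in> borel_measurable F"
    unfolding h_def by measurable
  have int_h: "integrable M (\<lambda>\<omega>. h \<omega> * g \<omega>)"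
    if "g \<in> borel_measurable M" "\<And>\<omega>. \<omega> \<in> G \<Longrightarrow> \<bar>g \<omega>\<bar> \<le> 1" for g
    unfolding h_def
    using f(2,3) that by (intro integrable_mult_bounded_on[where K = K]) auto
  \<comment> \<open>The strict bound comes from a positive budget and \<open>\<delta> < 1\<close>.
    It excludes an infinite quantile, for which passing the test would say nothing.\<close>
  have risk_bounds: "0 \<le> risk E t \<omega>" "risk E t \<omega> < 1" if "\<omega> \<in> G" for \<omega>
  proof -
    have \<omega>: "\<omega> \<in> space M" "t \<le> stages E \<omega>"
      using that G(2)[OF that] sets.sets_into_space[OF \<open>G \<in> sets M\<close>] by auto
    show "0 \<le> risk E t \<omega>"
      using follows_algorithmD(5)[OF FA t \<omega>] .
    have "0 < (1 - \<delta>) / survival_budget E (t - 1) \<omega>"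
      using follows_algorithmD(4)[OF FA t \<omega>] \<delta> by simp
    then show "risk E t \<omega> < 1"
      using follows_algorithmD(6)[OF FA t \<omega>] by linarith
  qed
  have "(\<integral>\<omega>. h \<omega> * indicator {\<omega>\<in>space M. total_cost E t \<omega> \<le> B} \<omega> \<partial>M)
      \<le> (\<integral>\<omega>. h \<omega> * indicator A \<omega> \<partial>M)"
  proof (rule integral_mono_AE[OF int_h int_h])
    show "AE \<omega> in M. h \<omega> * indicator {\<omega>\<in>space M. total_cost E t \<omega> \<le> B} \<omega> \<le> h \<omega> * indicator A \<omega>"
      using quotients_meaningful z_condition
    proof eventually_elim
      case (elim \<omega>)
      \<comment> \<open>Since \<open>B\<close> is at most the bound \<open>b_t\<close>, ruin bounds
        the gap by \<open>b_t\<close> minus the observed treated outcomes; the condition on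
        \<open>z_t\<close> carries this over from the model's standardisation to the true
        one.\<close>
      have "\<omega> \<in> A" if "\<omega> \<in> G" "\<omega> \<in> space M" "total_cost E t \<omega> \<le> B"
      proof -
        have "gap E t \<omega> \<le> bound E t \<omega> - ST E 1 (t - 1) \<omega>"
          using follows_algorithmD(7)[OF FA t \<open>\<omega> \<in> space M\<close>] G(2)[OF \<open>\<omega> \<in> G\<close>] that(3)
          by (simp add: total_cost_eq_gap[OF t])
        then show ?thesis
          using elim G(2)[OF \<open>\<omega> \<in> G\<close>] \<open>\<omega> \<in> space M\<close>
          by (auto simp: A_def z_score_def intro: standardised_gap_le)
      qed
      then show ?case
        using h[of \<omega>] by (auto simp: indicator_def h_def)
    qed
  qed (auto simp: indicator_def)
  \<comment> \<open>The weight \<open>h\<close> is \<open>F\<close>-measurable, so the indicator of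
    \<open>A\<close> may be replaced by its conditional probability.\<close>
  also have "\<dots> = (\<integral>\<omega>. h \<omega> * real_cond_exp M F (indicator A) \<omega> \<partial>M)"
    by (rule F.real_cond_exp_intg(2)[symmetric]) (auto intro!: int_h simp: indicator_def)
  also have "\<dots> \<le> (\<integral>\<omega>. h \<omega> * risk E t \<omega> \<partial>M)"
  proof (rule integral_mono_AE[OF _ int_h])
    show "integrable M (\<lambda>\<omega>. h \<omega> * real_cond_exp M F (indicator A) \<omega>)"
      by (rule F.real_cond_exp_intg(1)) (auto intro!: int_h simp: indicator_def)
    show "\<bar>risk E t \<omega>\<bar> \<le> 1" if "\<omega> \<in> G" for \<omega>
      using risk_bounds[OF that] by simp
    show "AE \<omega> in M. h \<omega> * real_cond_exp M F (indicator A) \<omega> \<le> h \<omega> * risk E t \<omega>"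
      using tail_condition
    proof eventually_elim
      case (elim \<omega>)
      show ?case
      proof (cases "\<omega> \<in> G")
        case True
        then have active: "t \<le> stages E \<omega>" "tsize E t \<omega> \<noteq> 0" and \<omega>: "\<omega> \<in> space M"
          using G(2) sets.sets_into_space[OF \<open>G \<in> sets M\<close>] by auto
        have "real_cond_exp M F (indicator A) \<omega> \<le> \<Phi> (z_score E t \<omega> (real (tsize E t \<omega>)))"
          using elim active by (simp add: cond_probability_def A_def F_def gap_def)
        also have "\<dots> \<le> risk E t \<omega>"
          using z_score_algorithm_size[of E t \<omega>] follows_algorithmD(8)[OF FA t \<omega>] active
            risk_bounds[OF True] by (intro \<Phi>_le_if_le_\<Phi>_inv) auto
        finally show ?thesis
          using h[of \<omega>] by (rule mult_left_mono)
      qed (simp add: h_def)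
    qed
  qed measurable
  finally show ?thesis
    by (simp add: h_def)
qed

section \<open>From single stages to the whole experiment\<close>

theorem theorem3p3:
  fixes M :: "'a measure" and E :: "('a, 'u) trial" and B \<delta> :: real
  assumes "prob_space M"
    and "B < 0" and "0 \<le> \<delta>" and "\<delta> < 1"
    and "randomised_experiment M E"
    and "follows_algorithm M E \<delta> B"
    and independent: "prob_space.indep_vars M (\<lambda>_. borel)
           (\<lambda>(t, i) \<omega>. (outcome E 0 t i \<omega>, outcome E 1 t i \<omega>)) {(t, i). 1 \<le> t \<and> i \<in> units E t}"
    and finite_moments: "\<And>t. 1 \<le> t \<Longrightarrow> AE \<omega> in M. t \<le> stages E \<omega> \<and> tsize E t \<omega> \<noteq> 0 \<longrightarrow>
           nn_cond_exp M (history M E (t - 1)) (\<lambda>\<omega>. ennreal ((gap E t \<omega>)\<^sup>2)) \<omega> < \<infinity>"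
    and quotients_meaningful: "\<And>t. 1 \<le> t \<Longrightarrow> AE \<omega> in M. t \<le> stages E \<omega> \<and> tsize E t \<omega> \<noteq> 0 \<longrightarrow>
           0 < sigma_breve M E t \<omega> \<and> sigma_breve M E t \<omega> < sigma_tilde E t \<omega> (real (tsize E t \<omega>))"
    and tail_condition: "\<And>t. 1 \<le> t \<Longrightarrow> AE \<omega> in M. t \<le> stages E \<omega> \<and> tsize E t \<omega> \<noteq> 0 \<longrightarrow>
           cond_probability M (history M E (t - 1))
             (\<lambda>\<omega>. (sT E 1 t \<omega> - ST E 0 t \<omega> - mu_breve M E t \<omega>) / sigma_breve M E t \<omega>
                    \<le> z_score E t \<omega> (real (tsize E t \<omega>))) \<omega>
           \<le> \<Phi> (z_score E t \<omega> (real (tsize E t \<omega>)))"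
    and z_condition: "\<And>t. 1 \<le> t \<Longrightarrow> AE \<omega> in M. t \<le> stages E \<omega> \<and> tsize E t \<omega> \<noteq> 0 \<longrightarrow>
           z_score E t \<omega> (real (tsize E t \<omega>))
           \<le> (mu_breve M E t \<omega> - mu_tilde E t \<omega> (real (tsize E t \<omega>)))
               / (sigma_tilde E t \<omega> (real (tsize E t \<omega>)) - sigma_breve M E t \<omega>)"
  shows "RRC M E \<delta> B"
proof -
  interpret prob_space M
    by fact
  note RE = \<open>randomised_experiment M E\<close> and FA = \<open>follows_algorithm M E \<delta> B\<close>
    and \<delta> = \<open>0 \<le> \<delta>\<close> \<open>\<delta> < 1\<close>
  define alive :: "nat \<Rightarrow> 'a \<Rightarrow> real" where "alive t = indicator {\<omega>\<in>space M. B < total_cost E t \<omega>}" for t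
  define V where "V t \<omega> = alive t \<omega> / survival_budget E t \<omega>" for t \<omega>
  \<comment> \<open>Stages after the last one run carry dummies, so \<open>V\<close> and
    \<open>alive\<close> are read at this truncated stage only.\<close>
  define T where "T n \<omega> = min n (stages E \<omega>)" for n \<omega>
  have from_history: "g \<in> borel_measurable M" if "g \<in> borel_measurable (history M E t)" for g :: "'a \<Rightarrow> real" and t
    using measurable_from_subalg[OF subalgebra_history[OF RE] that] .
  have st: "stopping_time (history M E) (stages E)"
    using RE unfolding randomised_experiment_def by (rule conjunct1)
  \<comment> \<open>Whether stage \<open>Suc t\<close> is run is already known after stage
    \<open>t\<close>; the event is the complement of having stopped by \<open>t\<close>.\<close>
  have stop: "Measurable.pred (history M E t) (\<lambda>\<omega>. Suc t \<le> stages E \<omega>)" for t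
    using stopping_timeD2[OF st, of t] by (simp only: Suc_le_eq)
  have [measurable]: "stages E \<in> measurable M (count_space UNIV)"
  proof -
    have "stages E \<in> borel_measurable M"
      using subalgebra_history[OF RE]
      by (intro measurable_stopping_time[OF st]) (simp_all add: subalgebra_def)
    then show ?thesis
      by (subst measurable_cong_sets[OF refl sets_borel_eq_count_space[symmetric]])
  qed
  have [measurable]: "T n \<in> measurable M (count_space UNIV)" for n
    unfolding T_def by measurable
  note [measurable] = measurable_total_cost[OF RE] from_history[OF measurable_survival_budget[OF FA]]
  have [measurable]: "alive t \<in> borel_measurable M" "V t \<in> borel_measurable M" for t
    unfolding alive_def V_def by measurable
  \<comment> \<open>The random index has countably many values, so measurability can be checked for
    each of them.\<close>
  have meas_T: "(\<lambda>\<omega>. g (T n \<omega>) \<omega>) \<in> borel_measurable M"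
    if "\<And>t. g t \<in> borel_measurable M" for g :: "nat \<Rightarrow> 'a \<Rightarrow> real" and n
    by (rule measurable_compose_countable[where f = g]) (use that in auto)
  note [measurable] = meas_T[of V] meas_T[of alive]
  have alive: "0 \<le> alive t \<omega>" "alive t \<omega> \<le> 1" for t \<omega>
    by (auto simp: alive_def indicator_def)
  have budget: "1 - \<delta> \<le> survival_budget E (T n \<omega>) \<omega>" if "\<omega> \<in> space M" for n \<omega>
    using that \<delta> by (intro survival_budget_ge[OF FA]) (auto simp: T_def)
  have V_le: "V (T n \<omega>) \<omega> \<le> alive (T n \<omega>) \<omega> / (1 - \<delta>)" "0 \<le> V (T n \<omega>) \<omega>" if "\<omega> \<in> space M" for n \<omega>
    using budget[OF that, of n] \<delta> alive[of "T n \<omega>" \<omega>] by (auto simp: V_def intro!: divide_left_mono)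
  have int_alive: "integrable M (\<lambda>\<omega>. alive (T n \<omega>) \<omega>)" for n
    using alive by (intro integrable_const_bound[where B = 1]) (auto intro!: AE_I2)
  have int_V: "integrable M (\<lambda>\<omega>. V (T n \<omega>) \<omega>)" for n
  proof (rule Bochner_Integration.integrable_bound[OF integrable_divide[OF int_alive[of n], of "1 - \<delta>"]])
    show "AE \<omega> in M. norm (V (T n \<omega>) \<omega>) \<le> norm (alive (T n \<omega>) \<omega> / (1 - \<delta>))"
      using V_le alive \<delta> by (intro AE_I2) simp
  qed measurable
  have V_ge: "1 \<le> (\<integral>\<omega>. V (T n \<omega>) \<omega> \<partial>M)" for n
  proof (induction n)
    case 0
    \<comment> \<open>No cost has been incurred yet and \<open>B < 0\<close>, while the empty
      product is 1.\<close>
    have "V (T 0 \<omega>) \<omega> = 1" if "\<omega> \<in> space M" for \<omega>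
      using \<open>B < 0\<close> that by (simp add: V_def T_def alive_def total_cost_def)
    then have "(\<integral>\<omega>. V (T 0 \<omega>) \<omega> \<partial>M) = (\<integral>\<omega>. 1 \<partial>M)"
      by (intro Bochner_Integration.integral_cong) auto
    then show ?case
      by (simp add: prob_space)
  next
    case (Suc n)
    define F where "F = history M E n"
    have sp: "space F = space M"
      by (simp add: F_def history_def)
    have [measurable]: "tsize E (Suc n) \<in> measurable F (count_space UNIV)"
      using randomised_experimentD(5)[OF RE, of "Suc n"] by (simp add: F_def)
    note [measurable] = stop[of n, folded F_def]
    define G where "G = {\<omega>\<in>space M. Suc n \<le> stages E \<omega> \<and> tsize E (Suc n) \<omega> \<noteq> 0}"
    have G: "G \<in> sets F"
      unfolding G_def sp[symmetric] by measurable
    have [measurable]: "G \<in> sets M"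
      using G subalgebra_history[OF RE, of n] unfolding F_def subalgebra_def by blast
    define f where "f \<omega> = 1 / survival_budget E (Suc n) \<omega>" for \<omega>
    have f: "f \<in> borel_measurable F"
      using measurable_survival_budget[OF FA, of "Suc n"] unfolding f_def F_def by (simp del: survival_budget_Suc)
    have [measurable]: "f \<in> borel_measurable M"
      by (rule from_history[OF f[unfolded F_def]])
    have [measurable]: "risk E (Suc n) \<in> borel_measurable M"
      by (rule from_history[OF follows_algorithmD(1)[OF FA]]) simp
    have pos: "1 - \<delta> \<le> survival_budget E (Suc n) \<omega>" "1 - \<delta> \<le> survival_budget E n \<omega>"
      "0 \<le> risk E (Suc n) \<omega>" "risk E (Suc n) \<omega> < 1"
      if "\<omega> \<in> space M" "Suc n \<le> stages E \<omega>" for \<omega>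
    proof -
      show *: "1 - \<delta> \<le> survival_budget E (Suc n) \<omega>" "1 - \<delta> \<le> survival_budget E n \<omega>"
        using budget[OF that(1), of "Suc n"] budget[OF that(1), of n] that(2) by (simp_all add: T_def)
      show "0 \<le> risk E (Suc n) \<omega>"
        using follows_algorithmD(5)[OF FA, of "Suc n"] that by simp
      have "0 < survival_budget E n \<omega> * (1 - risk E (Suc n) \<omega>)" "0 < survival_budget E n \<omega>"
        using * \<delta> by auto
      then show "risk E (Suc n) \<omega> < 1"
        by (simp add: zero_less_mult_iff)
    qed
    have f_bounds: "0 \<le> f \<omega>" "f \<omega> \<le> 1 / (1 - \<delta>)" if "\<omega> \<in> G" for \<omega>
      using pos[of \<omega>] that \<delta> unfolding f_def G_def by (auto intro!: divide_left_mono simp del: survival_budget_Suc)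
    \<comment> \<open>On active stages, \<open>gain\<close> is the increase of the reciprocal budget
      from \<open>n\<close> to \<open>Suc n\<close>, and \<open>loss\<close> is the new reciprocal
      budget, forfeited when the total cost is at most \<open>B\<close>.\<close>
    define loss where "loss \<omega> = indicator G \<omega> * f \<omega> * indicator {\<omega>\<in>space M. total_cost E (Suc n) \<omega> \<le> B} \<omega>" for \<omega>
    define gain where "gain \<omega> = indicator G \<omega> * f \<omega> * risk E (Suc n) \<omega>" for \<omega>
    have ruin: "(\<integral>\<omega>. loss \<omega> \<partial>M) \<le> (\<integral>\<omega>. gain \<omega> \<partial>M)"
      unfolding loss_def gain_def
    proof (rule cond_ruin_le_risk[OF RE FA \<delta>])
      show "1 \<le> Suc n"
        by simp
      then show "AE \<omega> in M. Suc n \<le> stages E \<omega> \<and> tsize E (Suc n) \<omega> \<noteq> 0 \<longrightarrow>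
           0 < sigma_breve M E (Suc n) \<omega> \<and>
           sigma_breve M E (Suc n) \<omega> < sigma_tilde E (Suc n) \<omega> (real (tsize E (Suc n) \<omega>))"
        by (rule quotients_meaningful)
    next
      show "G \<in> sets (history M E (Suc n - 1))" "f \<in> borel_measurable (history M E (Suc n - 1))"
        using G f by (simp_all add: F_def)
    next
      fix \<omega>
      assume "\<omega> \<in> G"
      then show "Suc n \<le> stages E \<omega> \<and> tsize E (Suc n) \<omega> \<noteq> 0" "0 \<le> f \<omega>" "f \<omega> \<le> 1 / (1 - \<delta>)"
        using f_bounds by (simp_all add: G_def)
    qed (rule tail_condition z_condition; simp)+
    \<comment> \<open>Holds pathwise; expectations are compared only afterwards, when
      \<open>ruin\<close> shows that the expected gain covers the expected loss.\<close>
    have step: "V (T n \<omega>) \<omega> + gain \<omega> - loss \<omega> \<le> V (T (Suc n) \<omega>) \<omega>" if \<omega>: "\<omega> \<in> space M" for \<omega>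
    proof (cases "Suc n \<le> stages E \<omega>")
      case False
      then have "T (Suc n) \<omega> = T n \<omega>"
        by (auto simp: T_def)
      with False show ?thesis
        by (simp add: G_def gain_def loss_def)
    next
      case run: True
      then have T: "T n \<omega> = n" "T (Suc n) \<omega> = Suc n"
        by (auto simp: T_def)
      note p = pos[OF \<omega> run]
      have pn: "0 < survival_budget E n \<omega>"
        using p(2) \<delta> by linarith
      show ?thesis
      proof (cases "tsize E (Suc n) \<omega> = 0")
        case True
        have "survival_budget E (Suc n) \<omega> \<le> survival_budget E n \<omega>"
          using pn p(3) by (simp add: mult_left_le)
        moreover have "0 < survival_budget E (Suc n) \<omega>"
          using p(1) \<delta> by linarith
        ultimately have "alive n \<omega> / survival_budget E n \<omega> \<le> alive n \<omega> / survival_budget E (Suc n) \<omega>"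
          using pn alive(1) by (intro divide_left_mono mult_pos_pos)
        moreover have "alive (Suc n) \<omega> = alive n \<omega>"
          using total_cost_tsize_0[OF RE \<omega> run True] \<omega> by (simp add: alive_def indicator_def)
        ultimately have "V n \<omega> \<le> V (Suc n) \<omega>"
          by (simp only: V_def)
        with True T show ?thesis
          by (simp add: G_def gain_def loss_def)
      next
        case False
        then have "\<omega> \<in> G"
          using run \<omega> by (simp add: G_def)
        \<comment> \<open>Bounding \<open>alive\<close> by 1 discards the event of survival up to
          \<open>n\<close>, which the history does not determine.\<close>
        have "V n \<omega> \<le> 1 / survival_budget E n \<omega>"
          using pn alive[of n \<omega>] by (simp add: V_def divide_right_mono)
        also have "\<dots> = f \<omega> * (1 - risk E (Suc n) \<omega>)"
          using pn p by (simp add: f_def)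
        finally have "V n \<omega> + f \<omega> * risk E (Suc n) \<omega> \<le> f \<omega>"
          by (simp add: algebra_simps)
        \<comment> \<open>At stage \<open>Suc n\<close> exactly one of ruin and survival holds, and
          each contributes \<open>f \<omega>\<close> to its own term.\<close>
        moreover have "loss \<omega> + V (Suc n) \<omega> = f \<omega>"
          using \<open>\<omega> \<in> G\<close> \<omega> by (auto simp: loss_def V_def f_def alive_def indicator_def)
        ultimately show ?thesis
          using \<open>\<omega> \<in> G\<close> T by (simp add: gain_def)
      qed
    qed
    have int: "integrable M gain" "integrable M loss"
    proof -
      have "\<bar>f \<omega>\<bar> \<le> 1 / (1 - \<delta>)" "\<bar>risk E (Suc n) \<omega>\<bar> \<le> 1" if "\<omega> \<in> G" for \<omega>
        using f_bounds[OF that] pos(3,4)[of \<omega>] that by (simp_all add: G_def)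
      then show "integrable M gain" "integrable M loss"
        unfolding gain_def loss_def
        by (intro integrable_mult_bounded_on[where K = "1 / (1 - \<delta>)"]; simp)+
    qed
    have "1 \<le> (\<integral>\<omega>. V (T n \<omega>) \<omega> \<partial>M) + (\<integral>\<omega>. gain \<omega> \<partial>M) - (\<integral>\<omega>. loss \<omega> \<partial>M)"
      using Suc ruin by linarith
    also have "\<dots> = (\<integral>\<omega>. V (T n \<omega>) \<omega> + gain \<omega> - loss \<omega> \<partial>M)"
      using int int_V by simp
    also have "\<dots> \<le> (\<integral>\<omega>. V (T (Suc n) \<omega>) \<omega> \<partial>M)"
      using int int_V step by (intro integral_mono) auto
    finally show ?case .
  qed
  have ge: "1 - \<delta> \<le> (\<integral>\<omega>. alive (T n \<omega>) \<omega> \<partial>M)" for n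
  proof -
    have "1 \<le> (\<integral>\<omega>. alive (T n \<omega>) \<omega> / (1 - \<delta>) \<partial>M)"
      using int_V int_alive V_le by (intro order.trans[OF V_ge[of n]] integral_mono) auto
    then show ?thesis
      using \<delta> by (simp add: pos_le_divide_eq)
  qed
  \<comment> \<open>The number of stages is finite on each path but need not be bounded; each path
    is eventually constant in \<open>n\<close>, and the constant 1 dominates.\<close>
  have "(\<lambda>n. \<integral>\<omega>. alive (T n \<omega>) \<omega> \<partial>M) \<longlonglongrightarrow> (\<integral>\<omega>. alive (stages E \<omega>) \<omega> \<partial>M)"
  proof (rule integral_dominated_convergence[where w = "\<lambda>_. 1"])
    show "AE \<omega> in M. (\<lambda>n. alive (T n \<omega>) \<omega>) \<longlonglongrightarrow> alive (stages E \<omega>) \<omega>"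
    proof (rule AE_I2)
      fix \<omega>
      have "\<forall>\<^sub>F n in sequentially. alive (T n \<omega>) \<omega> = alive (stages E \<omega>) \<omega>"
        using eventually_ge_at_top[of "stages E \<omega>"] by eventually_elim (simp add: T_def min_def)
      then show "(\<lambda>n. alive (T n \<omega>) \<omega>) \<longlonglongrightarrow> alive (stages E \<omega>) \<omega>"
        by (rule tendsto_eventually)
    qed
    show "(\<lambda>\<omega>. alive (stages E \<omega>) \<omega>) \<in> borel_measurable M"
      by (rule measurable_compose_countable[where f = alive]) measurable
  qed (use alive in auto)
  then have "1 - \<delta> \<le> (\<integral>\<omega>. alive (stages E \<omega>) \<omega> \<partial>M)"
    using ge by (intro LIMSEQ_le_const) auto
  also have "\<dots> = (\<integral>\<omega>. indicator {\<omega>\<in>space M. B < total_cost E (stages E \<omega>) \<omega>} \<omega> \<partial>M)"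
    by (intro Bochner_Integration.integral_cong) (auto simp: alive_def indicator_def)
  also have "\<dots> = measure M {\<omega>\<in>space M. B < total_cost E (stages E \<omega>) \<omega>}"
    by (simp add: Int_absorb2 subset_eq)
  finally show ?thesis
    by (simp add: RRC_def)
qed

end
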